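(* The affine variety $\mathrm{HLie}_m(\mathfrak{u}_2(\mathbb{C}))$ decomposes into three 4-dimensional irreducible components $V_1$, $V_2$, $V_3$, where $$V_1=\left\{\begin{pmatrix} a&0&c\\ b&0&d\\ a&0&c\end{pmatrix}\;\Big|\; a,b,c,d\in\mathbb{C}\right\},\quad V_2=\left\{\begin{pmatrix} a&0&d\\ b&c&-b\\ a-1&0&d+1\end{pmatrix}\;\Big|\; a,b,c,d\in\mathbb{C}\right\},$$ $$V_3=\left\{\begin{pmatrix} a&0&d\\ b&0&-b\\ c&0&a-c+d\end{pmatrix}\;\Big|\; a,b,c,d\in\mathbb{C}\right\}.$$
   Context: $\mathfrak{u}_2(\mathbb{C})$ is the Lie algebra of upper triangular complex $2\times 2$ matrices with the commutator bracket, with ordered basis $(E_{11},E_{12},E_{22})$ of matrix units. Linear maps of $\mathfrak{u}_2(\mathbb{C})$ are identified with $3\times 3$ complex matrices with respect to this ordered basis, the columns being the images of the basis vectors. A linear map $D:\mathfrak{g}\to\mathfrak{g}$ on a finite-dimensional complex Lie algebra $\mathfrak{g}$ is a Hom-Lie algebra structure on $\mathfrak{g}$ if $[D(x),[y,z]]+[D(y),[z,x]]+[D(z),[x,y]]=0$ for all $x,y,z\in\mathfrak{g}$; it is multiplicative if moreover $D([x,y])=[D(x),D(y)]$ for all $x,y\in\mathfrak{g}$. $\mathrm{HLie}_m(\mathfrak{g})$ is the set of all multiplicative Hom-Lie algebra structures on $\mathfrak{g}$, an affine variety (Zariski closed subset, not necessarily irreducible) in the space of $\dim\mathfrak{g}\times\dim\mathfrak{g}$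 complex matrices. Dimension means Krull dimension. *)

theory Defs
  imports "HOL-Analysis.Analysis"
begin

section \<open>Finite-dimensional complex Lie algebras with an ordered basis\<close>

text \<open>The Lie algebra is a subspace \<open>g\<close> of an ambient complex vector space. The basis \<open>e\<close> is
  indexed by a finite type \<open>'n\<close>, so that linear maps of \<open>g\<close> correspond to matrices
  in \<open>complex^'n^'n\<close>.\<close>

locale complex_lie_algebra = vector_space scale
  for scale :: "complex \<Rightarrow> 'a::ab_group_add \<Rightarrow> 'a" (infixr "*c" 75) +
  fixes g :: "'a set"
    and bracket :: "'a \<Rightarrow> 'a \<Rightarrow> 'a"
    and e :: "'n::finite \<Rightarrow> 'a"
  assumes subspace_g: "subspace g"
    and basis_inj: "inj e"
    and basis_independent: "independent (range e)"
    and basis_span: "span (range e) = g"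
    and bracket_closed: "\<lbrakk>x \<in> g; y \<in> g\<rbrakk> \<Longrightarrow> bracket x y \<in> g"
    and bracket_add_left: "\<lbrakk>x \<in> g; y \<in> g; z \<in> g\<rbrakk> \<Longrightarrow> bracket (x + y) z = bracket x z + bracket y z"
    and bracket_add_right: "\<lbrakk>x \<in> g; y \<in> g; z \<in> g\<rbrakk> \<Longrightarrow> bracket x (y + z) = bracket x y + bracket x z"
    and bracket_scale_left: "\<lbrakk>x \<in> g; y \<in> g\<rbrakk> \<Longrightarrow> bracket (k *c x) y = k *c bracket x y"
    and bracket_scale_right: "\<lbrakk>x \<in> g; y \<in> g\<rbrakk> \<Longrightarrow> bracket x (k *c y) = k *c bracket x y"
    and bracket_self: "x \<in> g \<Longrightarrow> bracket x x = 0"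
    and jacobi: "\<lbrakk>x \<in> g; y \<in> g; z \<in> g\<rbrakk> \<Longrightarrow>
      bracket x (bracket y z) + bracket y (bracket z x) + bracket z (bracket x y) = 0"
begin

definition linear_map :: "('a \<Rightarrow> 'a) \<Rightarrow> bool" where
  "linear_map D \<longleftrightarrow>
     (\<forall>x\<in>g. D x \<in> g) \<and>
     (\<forall>x\<in>g. \<forall>y\<in>g. D (x + y) = D x + D y) \<and>
     (\<forall>k. \<forall>x\<in>g. D (k *c x) = k *c D x)"

definition hom_lie_structure :: "('a \<Rightarrow> 'a) \<Rightarrow> bool" where
  "hom_lie_structure D \<longleftrightarrow> linear_map D \<and>
     (\<forall>x\<in>g. \<forall>y\<in>g. \<forall>z\<in>g.
        bracket (D x) (bracket y z) + bracket (D y) (bracket z x) + bracket (D z) (bracket x y) = 0)"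

definition multiplicative_hom_lie_structure :: "('a \<Rightarrow> 'a) \<Rightarrow> bool" where
  "multiplicative_hom_lie_structure D \<longleftrightarrow> hom_lie_structure D \<and>
     (\<forall>x\<in>g. \<forall>y\<in>g. D (bracket x y) = bracket (D x) (D y))"

text \<open>\<open>A $ i $ j\<close> is the \<open>i\<close>-th coordinate of the image of the \<open>j\<close>-th basis vector.\<close>

definition represents :: "complex^'n^'n \<Rightarrow> ('a \<Rightarrow> 'a) \<Rightarrow> bool" where
  "represents A D \<longleftrightarrow> (\<forall>j. D (e j) = (\<Sum>i\<in>UNIV. (A $ i $ j) *c e i))"

definition HLie_m :: "(complex^'n^'n) set" where
  "HLie_m = {A. \<exists>D. multiplicative_hom_lie_structure D \<and> represents A D}"

end


section \<open>The Lie algebra of upper triangular matrices\<close>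

definition mat_scale :: "complex \<Rightarrow> complex^'n^'m \<Rightarrow> complex^'n^'m" where
  "mat_scale k A = map_matrix ((*) k) A"

definition commutator :: "complex^'n^'n \<Rightarrow> complex^'n^'n \<Rightarrow> complex^'n^'n" where
  "commutator A B = A ** B - B ** A"

definition matrix_unit :: "'m \<Rightarrow> 'n \<Rightarrow> complex^'n^'m" where
  "matrix_unit i j = (\<chi> r s. if r = i \<and> s = j then 1 else 0)"

definition u2 :: "(complex^2^2) set" where
  "u2 = {A. A $ 2 $ 1 = 0}"

definition u2_basis :: "3 \<Rightarrow> complex^2^2" where
  "u2_basis k =
     (if k = 1 then matrix_unit 1 1 else if k = 2 then matrix_unit 1 2 else matrix_unit 2 2)"

lemma vector_space_mat_scale: "vector_space mat_scale"
  by unfold_locales (simp_all add: mat_scale_def vec_eq_iff algebra_simps)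

lemma inj_u2_basis: "inj u2_basis"
proof (rule injI)
  fix x y :: 3 assume "u2_basis x = u2_basis y"
  then show "x = y"
    using exhaust_3[of x] exhaust_3[of y]
    by (auto simp: u2_basis_def matrix_unit_def vec_eq_iff forall_2)
qed

lemma u2_basis_combination:
  "(\<Sum>v\<in>range u2_basis. mat_scale (f v) v) =
     (\<chi> i j. if i = 1 then (if j = 1 then f (u2_basis 1) else f (u2_basis 2))
            else (if j = 1 then 0 else f (u2_basis 3)))"
  by (simp add: sum.reindex[OF inj_u2_basis] sum_3)
    (auto simp: vec_eq_iff forall_2 mat_scale_def u2_basis_def matrix_unit_def)

interpretation u2: complex_lie_algebra mat_scale u2 commutator u2_basis
proof -
  interpret vector_space mat_scale by (rule vector_space_mat_scale)
  have sub: "subspace u2"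
    by (auto simp: subspace_def u2_def mat_scale_def)
  have ind: "independent (range u2_basis)"
    unfolding independent_explicit_module
  proof (intro allI impI)
    fix t f v
    assume t: "finite t" "t \<subseteq> range u2_basis" "(\<Sum>v\<in>t. mat_scale (f v) v) = 0" "v \<in> t"
    define h where "h w = (if w \<in> t then f w else 0)" for w
    have "(\<Sum>v\<in>range u2_basis. mat_scale (h v) v) = (\<Sum>v\<in>t. mat_scale (f v) v)"
      by (rule sum.mono_neutral_cong_right) (use t in \<open>auto simp: h_def\<close>)
    then have "(\<Sum>v\<in>range u2_basis. mat_scale (h v) v) = 0"
      using t by simp
    then have "h (u2_basis 1) = 0 \<and> h (u2_basis 2) = 0 \<and> h (u2_basis 3) = 0"
      unfolding u2_basis_combination by (auto simp: vec_eq_iff forall_2)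
    then have "h (u2_basis k) = 0" for k
      using exhaust_3[of k] by auto
    then have "h v = 0" using t by auto
    then show "f v = 0" using t by (simp add: h_def)
  qed
  have span: "span (range u2_basis) = u2"
  proof
    have "range u2_basis \<subseteq> u2"
      by (auto simp: u2_def u2_basis_def matrix_unit_def)
    then show "span (range u2_basis) \<subseteq> u2"
      using sub by (rule span_minimal)
  next
    show "u2 \<subseteq> span (range u2_basis)"
    proof
      fix A assume "A \<in> u2"
      then have "A = mat_scale (A $ 1 $ 1) (u2_basis 1) + mat_scale (A $ 1 $ 2) (u2_basis 2)
          + mat_scale (A $ 2 $ 2) (u2_basis 3)"
        by (auto simp: vec_eq_iff forall_2 mat_scale_def u2_basis_def matrix_unit_def u2_def)
      moreover have "\<dots> \<in> span (range u2_basis)"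
        by (intro span_add span_scale span_base rangeI)
      ultimately show "A \<in> span (range u2_basis)" by simp
    qed
  qed
  show "complex_lie_algebra mat_scale u2 commutator u2_basis"
  proof
    show "subspace u2" "inj u2_basis" "independent (range u2_basis)" "span (range u2_basis) = u2"
      by (fact sub inj_u2_basis ind span)+
  qed (simp_all add: u2_def commutator_def mat_scale_def vec_eq_iff forall_2
      matrix_matrix_mult_def sum_2 algebra_simps)
qed


section \<open>Zariski topology, irreducible components, Krull dimension\<close>

inductive_set polynomial_functions :: "(complex^'n^'m \<Rightarrow> complex) set" where
  const: "(\<lambda>A. k) \<in> polynomial_functions"
| entry: "(\<lambda>A. A $ i $ j) \<in> polynomial_functions"
| add: "\<lbrakk>p \<in> polynomial_functions; q \<in> polynomial_functions\<rbrakk>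
    \<Longrightarrow> (\<lambda>A. p A + q A) \<in> polynomial_functions"
| mult: "\<lbrakk>p \<in> polynomial_functions; q \<in> polynomial_functions\<rbrakk>
    \<Longrightarrow> (\<lambda>A. p A * q A) \<in> polynomial_functions"

definition zero_locus :: "(complex^'n^'m \<Rightarrow> complex) set \<Rightarrow> (complex^'n^'m) set" where
  "zero_locus P = {A. \<forall>p\<in>P. p A = 0}"

definition zariski_topology :: "(complex^'n^'m) topology" where
  "zariski_topology = topology (\<lambda>U. \<exists>P\<subseteq>polynomial_functions. U = - zero_locus P)"

lemma openin_zariski_topology:
  fixes U :: "(complex^'n^'m) set"
  shows "openin zariski_topology U \<longleftrightarrow> (\<exists>P\<subseteq>polynomial_functions. U = - zero_locus P)"
proof -
  have "istopology (\<lambda>U::(complex^'n^'m) set. \<exists>P\<subseteq>polynomial_functions. U = - zero_locus P)"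
    unfolding istopology_def
  proof (intro conjI allI impI)
    fix S T :: "(complex^'n^'m) set"
    assume "\<exists>P\<subseteq>polynomial_functions. S = - zero_locus P"
      and "\<exists>Q\<subseteq>polynomial_functions. T = - zero_locus Q"
    then obtain P Q where P: "P \<subseteq> polynomial_functions" "S = - zero_locus P"
      and Q: "Q \<subseteq> polynomial_functions" "T = - zero_locus Q" by auto
    let ?R = "(\<lambda>(p, q) A. p A * q A) ` (P \<times> Q)"
    have "?R \<subseteq> polynomial_functions"
      using P Q by (auto intro!: polynomial_functions.mult)
    moreover have "S \<inter> T = - zero_locus ?R"
      using P Q by (auto simp: zero_locus_def)
    ultimately show "\<exists>R\<subseteq>polynomial_functions. S \<inter> T = - zero_locus R" by blast
  next
    fix K :: "(complex^'n^'m) set set"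
    assume K: "\<forall>U\<in>K. \<exists>P\<subseteq>polynomial_functions. U = - zero_locus P"
    let ?R = "\<Union>{P. P \<subseteq> polynomial_functions \<and> - zero_locus P \<in> K}"
    have "\<Union>K = - zero_locus ?R"
    proof (intro set_eqI iffI)
      fix A assume "A \<in> \<Union>K"
      then obtain P where "P \<subseteq> polynomial_functions" "- zero_locus P \<in> K" "A \<in> - zero_locus P"
        using K by force
      then show "A \<in> - zero_locus ?R" by (auto simp: zero_locus_def)
    next
      fix A assume "A \<in> - zero_locus ?R"
      then obtain P p where "P \<subseteq> polynomial_functions" "- zero_locus P \<in> K" "p \<in> P" "p A \<noteq> 0"
        by (auto simp: zero_locus_def)
      then have "A \<in> - zero_locus P" by (auto simp: zero_locus_def)
      then show "A \<in> \<Union>K" using \<open>- zero_locus P \<in> K\<close> by blast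
    qed
    moreover have "?R \<subseteq> polynomial_functions" by auto
    ultimately show "\<exists>R\<subseteq>polynomial_functions. \<Union>K = - zero_locus R"
      by (intro exI[of _ ?R] conjI)
  qed
  then show ?thesis by (simp add: zariski_topology_def)
qed

lemma topspace_zariski_topology [simp]: "topspace zariski_topology = UNIV"
proof -
  have "openin zariski_topology (UNIV :: (complex^'a^'b) set)"
    unfolding openin_zariski_topology
    by (rule exI[of _ "{\<lambda>A. 1}"]) (auto simp: zero_locus_def intro: polynomial_functions.const)
  then show ?thesis using openin_subset by blast
qed

lemma closedin_zariski_topology:
  "closedin zariski_topology V \<longleftrightarrow> (\<exists>P\<subseteq>polynomial_functions. V = zero_locus P)"
  by (simp add: closedin_def openin_zariski_topology Compl_eq_Diff_UNIV[symmetric])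

definition irreducible_in :: "'a topology \<Rightarrow> 'a set \<Rightarrow> bool" where
  "irreducible_in X S \<longleftrightarrow> S \<subseteq> topspace X \<and> S \<noteq> {} \<and>
     (\<forall>A B. closedin X A \<longrightarrow> closedin X B \<longrightarrow> S \<subseteq> A \<union> B \<longrightarrow> S \<subseteq> A \<or> S \<subseteq> B)"

definition irreducible_components :: "'a topology \<Rightarrow> 'a set set" where
  "irreducible_components X =
     {C. irreducible_in X C \<and> (\<forall>C'. irreducible_in X C' \<longrightarrow> C \<subseteq> C' \<longrightarrow> C' = C)}"

text \<open>The value for the empty space, usually \<open>-\<infinity>\<close>, is \<open>0\<close> here.\<close>

definition krull_dim :: "'a topology \<Rightarrow> enat" where
  "krull_dim X = Sup {enat n | n. \<exists>Z :: nat \<Rightarrow> 'a set.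
     (\<forall>i\<le>n. closedin X (Z i) \<and> irreducible_in X (Z i)) \<and> (\<forall>i<n. Z i \<subset> Z (Suc i))}"

abbreviation zariski_subspace :: "(complex^'n^'m) set \<Rightarrow> (complex^'n^'m) topology" where
  "zariski_subspace V \<equiv> subtopology zariski_topology V"


section \<open>The three families\<close>

definition V1 :: "(complex^3^3) set" where
  "V1 = {vector [vector [a, 0, c],
                 vector [b, 0, d],
                 vector [a, 0, c]] | a b c d. True}"

definition V2 :: "(complex^3^3) set" where
  "V2 = {vector [vector [a,     0, d],
                 vector [b,     c, - b],
                 vector [a - 1, 0, d + 1]] | a b c d. True}"

definition V3 :: "(complex^3^3) set" where
  "V3 = {vector [vector [a, 0, d],
                 vector [b, 0, - b],
                 vector [c, 0, a - c + d]] | a b c d. True}"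

end

theory Submission
  imports Defs "HOL-Library.Function_Algebras" "HOL-Computational_Algebra.Polynomial"
begin

text \<open>
  Let \<open>a\<^sub>i\<^sub>j\<close> be the entries of the matrix of \<open>D\<close> and put \<open>w = a\<^sub>1\<^sub>1 - a\<^sub>3\<^sub>1\<close>. The derived algebra of
  \<open>u2\<close> is spanned by \<open>E\<^sub>1\<^sub>2\<close>, and \<open>[xE\<^sub>1\<^sub>1 + yE\<^sub>1\<^sub>2 + zE\<^sub>2\<^sub>2, E\<^sub>1\<^sub>2] = (x - z)E\<^sub>1\<^sub>2\<close>. Hence \<open>D\<close> is a multiplicative
  Hom-Lie structure exactly if \<open>D E\<^sub>1\<^sub>2 = a\<^sub>2\<^sub>2E\<^sub>1\<^sub>2\<close>, \<open>a\<^sub>2\<^sub>2 = a\<^sub>2\<^sub>2w\<close>, \<open>w = a\<^sub>3\<^sub>3 - a\<^sub>1\<^sub>3\<close> and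
  \<open>(a\<^sub>2\<^sub>1 + a\<^sub>2\<^sub>3)w = 0\<close> (lemma \<open>HLie_m_u2_iff\<close>). The two products split into the cases \<open>w = 0\<close>,
  \<open>w = 1\<close>, and \<open>a\<^sub>2\<^sub>2 = 0\<close> with \<open>a\<^sub>2\<^sub>3 = - a\<^sub>2\<^sub>1\<close>, which are \<open>V1\<close>, \<open>V2\<close> and \<open>V3\<close>.

  Each of the three is an affine subspace of the space of matrices, parametrized by four of its
  entries, so it is closed. It is irreducible because two points of an affine subspace lie on a
  line inside it, and a product of two nonzero polynomials in one variable is nonzero. None of the
  three contains another, so they are the irreducible components of their union.

  An affine space of dimension \<open>d\<close> has the flag of coordinate subspaces as a chain of length \<open>d\<close>.
  That no chain \<open>Z\<^sub>0 \<subset> \<dots> \<subset> Z\<^sub>n\<close> is longer is a counting argument. Choose polynomial functions \<open>f\<^sub>i\<close>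
  that vanish on \<open>Z\<^sub>i\<close> but not on all of the next set. By irreducibility the monomials in
  \<open>f\<^sub>0, \<dots>, f\<^sub>n\<^sub>-\<^sub>1\<close> are linearly independent as functions on \<open>Z\<^sub>n\<close>
  (lemma \<open>independent_on_monomials_of_chain\<close>). There are \<open>(M + 1)\<^sup>n\<close> of them with exponents at most \<open>M\<close>.
  As functions of the \<open>d\<close> parameters they have degree \<open>O(M)\<close>, so they lie in a space of dimension
  \<open>O(M\<^sup>d)\<close>; letting \<open>M\<close> grow gives \<open>n \<le> d\<close>.
\<close>

section \<open>Irreducible sets and components\<close>

lemma irreducible_in_subtopology:
  "irreducible_in (subtopology X S) Z \<longleftrightarrow> Z \<subseteq> S \<and> irreducible_in X Z" (is "?L \<longleftrightarrow> ?R")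
proof
  assume L: ?L
  then have Z: "Z \<subseteq> S" "Z \<subseteq> topspace X" "Z \<noteq> {}" by (auto simp: irreducible_in_def)
  have "Z \<subseteq> A \<or> Z \<subseteq> B" if "closedin X A" "closedin X B" "Z \<subseteq> A \<union> B" for A B
  proof -
    have "closedin (subtopology X S) (A \<inter> S)" "closedin (subtopology X S) (B \<inter> S)"
      using that by (auto simp: closedin_subtopology)
    moreover have "Z \<subseteq> A \<inter> S \<union> B \<inter> S" using that Z by auto
    ultimately have "Z \<subseteq> A \<inter> S \<or> Z \<subseteq> B \<inter> S"
      using L unfolding irreducible_in_def by blast
    then show ?thesis by auto
  qed
  with Z show ?R by (auto simp: irreducible_in_def)
next
  assume R: ?R
  have "Z \<subseteq> A \<or> Z \<subseteq> B"
    if AB: "closedin (subtopology X S) A" "closedin (subtopology X S) B" "Z \<subseteq> A \<union> B" for A B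
  proof -
    obtain A' B' where "closedin X A'" "A = A' \<inter> S" "closedin X B'" "B = B' \<inter> S"
      using AB by (auto simp: closedin_subtopology)
    moreover from this have "Z \<subseteq> A' \<or> Z \<subseteq> B'"
      using R AB(3) unfolding irreducible_in_def by blast
    ultimately show ?thesis using R by auto
  qed
  with R show ?L by (auto simp: irreducible_in_def)
qed

text \<open>Irreducibility speaks of covers by two closed sets; peeling off one member at a time extends
  it to finite covers.\<close>

lemma irreducible_in_finite_closed_cover:
  assumes "irreducible_in X Z" "finite F" "\<And>C. C \<in> F \<Longrightarrow> closedin X C" "Z \<subseteq> \<Union>F"
  shows "\<exists>C\<in>F. Z \<subseteq> C"
  using assms(2-)
proof (induction F)
  case empty
  then show ?case using assms(1) by (auto simp: irreducible_in_def)
next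
  case (insert C F)
  have "closedin X (\<Union>F)" using insert.hyps insert.prems by (intro closedin_Union) auto
  moreover have "closedin X C" "Z \<subseteq> C \<union> \<Union>F" using insert.prems by auto
  ultimately have "Z \<subseteq> C \<or> Z \<subseteq> \<Union>F"
    using assms(1) unfolding irreducible_in_def by blast
  then show ?case using insert by auto
qed

text \<open>Every irreducible subset, whether closed or not, lies in a member of the cover, so the
  maximal irreducible sets are members; the antichain condition makes every member maximal.\<close>

lemma irreducible_components_finite_closed_cover:
  assumes F: "finite F" "\<And>C. C \<in> F \<Longrightarrow> closedin X C" "\<And>C. C \<in> F \<Longrightarrow> irreducible_in X C"
    and cover: "topspace X = \<Union>F"
    and antichain: "\<And>C C'. \<lbrakk>C \<in> F; C' \<in> F; C \<subseteq> C'\<rbrakk> \<Longrightarrow> C = C'"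
  shows "irreducible_components X = F"
proof -
  have *: "\<exists>C\<in>F. Z \<subseteq> C" if "irreducible_in X Z" for Z
    using irreducible_in_finite_closed_cover[OF that F(1,2)] that cover
    by (auto simp: irreducible_in_def)
  show ?thesis
  proof (intro set_eqI iffI)
    fix C assume "C \<in> irreducible_components X"
    then show "C \<in> F"
      using * F(3) unfolding irreducible_components_def by blast
  next
    fix C assume C: "C \<in> F"
    have "Z = C" if Z: "irreducible_in X Z" "C \<subseteq> Z" for Z
    proof -
      obtain C' where "C' \<in> F" "Z \<subseteq> C'" using * Z by blast
      with Z C antichain[of C C'] show ?thesis by auto
    qed
    with C F(3) show "C \<in> irreducible_components X"
      by (auto simp: irreducible_components_def)
  qed
qed

section \<open>Polynomial functions\<close>

lemma polynomial_functions_sum: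
  assumes "\<And>i. i \<in> I \<Longrightarrow> p i \<in> polynomial_functions"
  shows "(\<lambda>A. \<Sum>i\<in>I. p i A) \<in> polynomial_functions"
  using assms
  by (induction I rule: infinite_finite_induct)
    (auto intro: polynomial_functions.const polynomial_functions.add)

lemma polynomial_functions_power:
  "p \<in> polynomial_functions \<Longrightarrow> (\<lambda>A. p A ^ k) \<in> polynomial_functions"
  by (induction k) (auto intro: polynomial_functions.const polynomial_functions.mult)

lemma polynomial_functions_diff:
  assumes "p \<in> polynomial_functions" "q \<in> polynomial_functions"
  shows "(\<lambda>A. p A - q A) \<in> polynomial_functions"
  using polynomial_functions.add[OF assms(1)
      polynomial_functions.mult[OF polynomial_functions.const[of "-1"] assms(2)]]
  by simp

lemma closedin_zariski_zeros:
  "p \<in> polynomial_functions \<Longrightarrow> closedin zariski_topology {A. p A = 0}"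
  unfolding closedin_zariski_topology
  by (rule exI[of _ "{p}"]) (auto simp: zero_locus_def)

text \<open>The ring of polynomial functions on an irreducible set is a domain: the zero sets of two
  factors of zero cover the set. The nonzero value of \<open>q\<close> at \<open>B\<close> lets \<open>q\<close> be cancelled.\<close>

lemma irreducible_in_zariski_no_zero_divisors:
  assumes "irreducible_in zariski_topology Z" "p \<in> polynomial_functions" "q \<in> polynomial_functions"
    and "\<And>A. A \<in> Z \<Longrightarrow> p A * q A = 0" and "B \<in> Z" "q B \<noteq> 0" and "A \<in> Z"
  shows "p A = 0"
proof -
  have "Z \<subseteq> {A. p A = 0} \<union> {A. q A = 0}" using assms(4) by auto
  then have "Z \<subseteq> {A. p A = 0} \<or> Z \<subseteq> {A. q A = 0}"
    using assms(1) closedin_zariski_zeros[OF assms(2)] closedin_zariski_zeros[OF assms(3)]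
    unfolding irreducible_in_def by blast
  then show ?thesis using assms by auto
qed

lemma polynomial_function_on_line:
  assumes "p \<in> polynomial_functions"
  shows "\<exists>q. \<forall>l. p (A + mat_scale l B) = poly q l"
  using assms
proof induction
  case (const k)
  show ?case by (rule exI[of _ "[:k:]"]) simp
next
  case (entry i j)
  show ?case by (rule exI[of _ "[:A $ i $ j, B $ i $ j:]"]) (simp add: mat_scale_def)
next
  case (add p q)
  then show ?case by (metis poly_add)
next
  case (mult p q)
  then show ?case by (metis poly_mult)
qed

text \<open>If neither closed set contains \<open>S\<close>, join a point of \<open>S\<close> outside the first to one outside
  the second. The line lies in \<open>S\<close>, so along it the product of one equation of each closed set
  vanishes, although neither factor vanishes identically.\<close>

lemma irreducible_in_zariski_affine:
  assumes "S \<noteq> {}" and line: "\<And>A B l. \<lbrakk>A \<in> S; B \<in> S\<rbrakk> \<Longrightarrow> A + mat_scale l (B - A) \<in> S"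
  shows "irreducible_in zariski_topology S"
  unfolding irreducible_in_def
proof (intro conjI allI impI, goal_cases)
  case (3 Y Z)
  show ?case
  proof (rule ccontr)
    assume "\<not> (S \<subseteq> Y \<or> S \<subseteq> Z)"
    then obtain A B where AB: "A \<in> S" "A \<notin> Y" "B \<in> S" "B \<notin> Z" by auto
    obtain p where p: "p \<in> polynomial_functions" "p A \<noteq> 0" "\<And>C. C \<in> Y \<Longrightarrow> p C = 0"
      using 3(1) AB unfolding closedin_zariski_topology zero_locus_def by blast
    obtain q where q: "q \<in> polynomial_functions" "q B \<noteq> 0" "\<And>C. C \<in> Z \<Longrightarrow> q C = 0"
      using 3(2) AB unfolding closedin_zariski_topology zero_locus_def by blast
    obtain p' where p': "\<And>l. p (A + mat_scale l (B - A)) = poly p' l"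
      using polynomial_function_on_line[OF p(1)] by metis
    obtain q' where q': "\<And>l. q (A + mat_scale l (B - A)) = poly q' l"
      using polynomial_function_on_line[OF q(1)] by metis
    have "poly (p' * q') l = 0" for l
      using line[OF AB(1,3), of l] 3(3) p(3) q(3) p'[of l] q'[of l] by auto
    then have "p' = 0 \<or> q' = 0" using poly_all_0_iff_0 by (metis mult_eq_0_iff)
    moreover have "A + mat_scale 0 (B - A) = A" "A + mat_scale 1 (B - A) = B"
      by (auto simp: mat_scale_def vec_eq_iff)
    ultimately show False using p'[of 0] q'[of 1] p(2) q(2) by auto
  qed
qed (use assms in auto)

section \<open>Linear independence along a chain of irreducible sets\<close>

text \<open>Linear independence of an indexed family of functions after restriction to \<open>Z\<close>. Indexing makes
  repetitions count as dependence, so that cardinalities of index sets can be compared with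
  dimensions.\<close>

definition independent_on :: "'x set \<Rightarrow> 'i set \<Rightarrow> ('i \<Rightarrow> 'x \<Rightarrow> complex) \<Rightarrow> bool" where
  "independent_on Z I g \<longleftrightarrow>
     (\<forall>c. (\<forall>x\<in>Z. (\<Sum>i\<in>I. c i * g i x) = 0) \<longrightarrow> (\<forall>i\<in>I. c i = 0))"

text \<open>This is the step from one member of a chain to the next. Write a relation on \<open>Z\<close> as a
  polynomial in \<open>f\<close>. Restricted to \<open>Z'\<close>, where \<open>f\<close> is zero, only the constant term survives, so
  its coefficients are zero by independence there. The rest is divisible by \<open>f\<close>, which can be
  cancelled on the irreducible set \<open>Z\<close>, leaving a relation of lower degree in \<open>f\<close>.\<close>

lemma independent_on_times_powers:
  assumes Z: "irreducible_in zariski_topology Z" and sub: "Z' \<subseteq> Z"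
    and f: "f \<in> polynomial_functions" "\<And>x. x \<in> Z' \<Longrightarrow> f x = 0" and y: "y \<in> Z" "f y \<noteq> 0"
    and g: "\<And>i. i \<in> I \<Longrightarrow> g i \<in> polynomial_functions" and ind: "independent_on Z' I g"
  shows "independent_on Z ({..M} \<times> I) (\<lambda>(k, i) x. g i x * f x ^ k)"
proof -
  have *: "\<forall>k\<le>M. \<forall>i\<in>I. c k i = 0"
    if "\<And>x. x \<in> Z \<Longrightarrow> (\<Sum>k\<le>M. \<Sum>i\<in>I. c k i * (g i x * f x ^ k)) = 0" for M c
    using that
  proof (induction M arbitrary: c)
    case 0
    then show ?case using ind sub by (auto simp: independent_on_def)
  next
    case (Suc M)
    let ?h = "\<lambda>x. \<Sum>k\<le>M. \<Sum>i\<in>I. c (Suc k) i * (g i x * f x ^ k)"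
    have split: "(\<Sum>k\<le>Suc M. \<Sum>i\<in>I. c k i * (g i x * f x ^ k)) = (\<Sum>i\<in>I. c 0 i * g i x) + ?h x * f x" for x
      by (subst sum.atMost_Suc_shift) (simp add: sum_distrib_left sum_distrib_right mult_ac)
    have "(\<Sum>i\<in>I. c 0 i * g i x) = 0" if "x \<in> Z'" for x
      using Suc.prems[of x] split[of x] f(2)[OF that] sub that by auto
    then have c0: "\<forall>i\<in>I. c 0 i = 0" using ind by (auto simp: independent_on_def)
    have "?h x = 0" if "x \<in> Z" for x
    proof (rule irreducible_in_zariski_no_zero_divisors[OF Z _ f(1) _ y that])
      show "?h \<in> polynomial_functions"
        by (intro polynomial_functions_sum polynomial_functions.mult polynomial_functions.const
            polynomial_functions_power f g)
      show "?h x * f x = 0" if "x \<in> Z" for x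
        using Suc.prems[OF that] split[of x] c0 by simp
    qed
    then have "\<forall>k\<le>M. \<forall>i\<in>I. c (Suc k) i = 0" by (rule Suc.IH)
    then show ?case using c0 by (metis Suc_le_mono not0_implies_Suc)
  qed
  show ?thesis
    unfolding independent_on_def
  proof (intro allI impI)
    fix c assume "\<forall>x\<in>Z. (\<Sum>i\<in>{..M} \<times> I. c i * (case i of (k, i) \<Rightarrow> \<lambda>x. g i x * f x ^ k) x) = 0"
    then have "(\<Sum>k\<le>M. \<Sum>i\<in>I. c (k, i) * (g i x * f x ^ k)) = 0" if "x \<in> Z" for x
      using that by (simp add: sum.cartesian_product case_prod_unfold)
    from *[of "\<lambda>k i. c (k, i)", OF this] show "\<forall>i\<in>{..M} \<times> I. c i = 0" by auto
  qed
qed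

lemma independent_on_reindex:
  assumes "inj_on h I" "independent_on Z I (\<lambda>i. g (h i))"
  shows "independent_on Z (h ` I) g"
  unfolding independent_on_def
proof (intro allI impI)
  fix c assume "\<forall>x\<in>Z. (\<Sum>i\<in>h ` I. c i * g i x) = 0"
  then have "\<forall>x\<in>Z. (\<Sum>i\<in>I. c (h i) * g (h i) x) = 0"
    using assms(1) by (simp add: sum.reindex)
  then have "\<forall>i\<in>I. c (h i) = 0"
    using assms(2)[unfolded independent_on_def, rule_format, of "\<lambda>i. c (h i)"] by auto
  then show "\<forall>i\<in>h ` I. c i = 0" by simp
qed

definition monomial :: "nat \<Rightarrow> (nat \<Rightarrow> complex) \<Rightarrow> (nat \<Rightarrow> nat) \<Rightarrow> complex" where
  "monomial n v a = (\<Prod>i<n. v i ^ a i)"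

text \<open>Extensional functions are used so that each monomial has just one exponent vector and the set
  is finite.\<close>

definition exponents :: "nat \<Rightarrow> nat \<Rightarrow> (nat \<Rightarrow> nat) set" where
  "exponents n M = {..<n} \<rightarrow>\<^sub>E {..M}"

lemma finite_exponents: "finite (exponents n M)"
  by (simp add: exponents_def finite_PiE)

lemma card_exponents: "card (exponents n M) = (M + 1) ^ n"
  by (simp add: exponents_def card_funcsetE)

lemma polynomial_functions_monomial:
  assumes "\<And>i. i < n \<Longrightarrow> f i \<in> polynomial_functions"
  shows "(\<lambda>A. monomial n (\<lambda>i. f i A) a) \<in> polynomial_functions"
  using assms unfolding monomial_def
  by (induction n)
    (auto intro!: polynomial_functions.const polynomial_functions.mult polynomial_functions_power)

text \<open>In other words, \<open>f 0, \<dots>, f (n - 1)\<close> are algebraically independent on \<open>Z n\<close>. A monomial in one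
  more function is a monomial in the old ones times a power of the new one.\<close>

lemma independent_on_monomials_of_chain:
  assumes "\<And>i. i \<le> n \<Longrightarrow> irreducible_in zariski_topology (Z i)"
    and "\<And>i. i < n \<Longrightarrow> Z i \<subseteq> Z (Suc i)"
    and "\<And>i. i < n \<Longrightarrow> f i \<in> polynomial_functions"
    and "\<And>i A. \<lbrakk>i < n; A \<in> Z i\<rbrakk> \<Longrightarrow> f i A = 0"
    and "\<And>i. i < n \<Longrightarrow> \<exists>A\<in>Z (Suc i). f i A \<noteq> 0"
  shows "independent_on (Z n) (exponents n M) (\<lambda>a A. monomial n (\<lambda>i. f i A) a)"
  using assms
proof (induction n)
  case 0
  then show ?case
    by (auto simp: independent_on_def exponents_def monomial_def irreducible_in_def)
next
  case (Suc n)
  obtain y where y: "y \<in> Z (Suc n)" "f n y \<noteq> 0" using Suc.prems(5)[of n] by auto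
  have IH: "independent_on (Z n) (exponents n M) (\<lambda>a A. monomial n (\<lambda>i. f i A) a)"
    by (rule Suc.IH) (use Suc.prems in auto)
  have "independent_on (Z (Suc n)) ({..M} \<times> exponents n M)
      (\<lambda>(k, a) A. monomial n (\<lambda>i. f i A) a * f n A ^ k)"
  proof (rule independent_on_times_powers[where Z' = "Z n"])
    show "irreducible_in zariski_topology (Z (Suc n))" "Z n \<subseteq> Z (Suc n)"
      "f n \<in> polynomial_functions" "\<And>A. A \<in> Z n \<Longrightarrow> f n A = 0"
      using Suc.prems by auto
    show "(\<lambda>A. monomial n (\<lambda>i. f i A) a) \<in> polynomial_functions" for a
      using Suc.prems by (intro polynomial_functions_monomial) auto
  qed (fact y IH)+
  moreover have "monomial (Suc n) v (a(n := k)) = monomial n v a * v n ^ k" for v a k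
    by (simp add: monomial_def)
  ultimately have "independent_on (Z (Suc n)) ({..M} \<times> exponents n M)
      (\<lambda>p A. monomial (Suc n) (\<lambda>i. f i A) (case p of (k, a) \<Rightarrow> a(n := k)))"
    by (simp add: case_prod_unfold)
  moreover have "exponents (Suc n) M = (\<lambda>(k, a). a(n := k)) ` ({..M} \<times> exponents n M)"
    by (simp add: exponents_def lessThan_Suc PiE_insert_eq)
  moreover have "inj_on (\<lambda>(k, a). a(n := k)) ({..M} \<times> exponents n M)"
    unfolding exponents_def by (rule inj_combinator) simp
  ultimately show ?case by (simp add: independent_on_reindex)
qed

section \<open>Counting functions of bounded degree\<close>

text \<open>The vector space structure is interpreted in a local block only, since its simplification
  rules with scaling \<open>\<lambda>x. c * f x\<close> apply to too many terms.\<close>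

context
begin

interpretation complex_functions: vector_space "\<lambda>(c::complex) f x. c * f x"
  by unfold_locales (auto simp: fun_eq_iff algebra_simps)

lemma sum_functions_apply: "(\<Sum>i\<in>I. F i) x = (\<Sum>i\<in>I. F i x)"
  for F :: "'i \<Rightarrow> 'x \<Rightarrow> complex"
  by (induction I rule: infinite_finite_induct) auto

text \<open>The bound of the size of an independent set by that of a spanning set, for indexed families:
  independence first shows that no function occurs twice.\<close>

lemma card_le_of_independent_on:
  assumes "finite I" "finite T" and ind: "independent_on UNIV I g"
    and span: "\<And>i. i \<in> I \<Longrightarrow> g i \<in> complex_functions.span T"
  shows "card I \<le> card T"
proof -
  have inj: "inj_on g I"
  proof (rule inj_onI, rule ccontr)
    fix i j assume ij: "i \<in> I" "j \<in> I" "g i = g j" "i \<noteq> j"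
    let ?c = "\<lambda>k. (if k = i then 1 else 0) - (if k = j then 1 else (0::complex))"
    have "(\<Sum>k\<in>I. ?c k * g k x) = g i x - g j x" for x
      using ij assms(1) by (simp add: left_diff_distrib sum_subtractf if_distrib[of "\<lambda>z. z * _"] cong: if_cong)
    then have "\<forall>x\<in>UNIV. (\<Sum>k\<in>I. ?c k * g k x) = 0" by (simp only: ij(3)) simp
    then have "\<forall>k\<in>I. ?c k = 0"
      using ind[unfolded independent_on_def, THEN spec, of ?c] by blast
    from bspec[OF this ij(1)] show False using ij(4) by simp
  qed
  have "complex_functions.independent (g ` I)"
  proof (rule complex_functions.independent_if_scalars_zero)
    fix u v assume u: "(\<Sum>v\<in>g ` I. (\<lambda>x. u v * v x)) = 0" and v: "v \<in> g ` I"
    have "(\<Sum>i\<in>I. u (g i) * g i x) = 0" for x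
      using fun_cong[OF u, of x] by (simp add: sum.reindex[OF inj] sum_functions_apply)
    then have "\<forall>i\<in>I. u (g i) = 0"
      using ind[unfolded independent_on_def, rule_format, of "\<lambda>i. u (g i)"] by auto
    then show "u v = 0" using v by auto
  qed (use assms in auto)
  then have "card (g ` I) \<le> card T"
    using complex_functions.independent_span_bound[OF assms(2)] span by blast
  then show ?thesis by (simp add: card_image[OF inj])
qed

text \<open>The degree is bounded in each of the variables \<open>t 0, \<dots>, t (d - 1)\<close> separately, which makes the
  monomials easy to count.\<close>

definition bounded_degree :: "nat \<Rightarrow> nat \<Rightarrow> ((nat \<Rightarrow> complex) \<Rightarrow> complex) set" where
  "bounded_degree d N = complex_functions.span ((\<lambda>a t. monomial d t a) ` exponents d N)"

lemma card_le_of_independent_on_bounded_degree: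
  assumes "finite I" "independent_on UNIV I g" "\<And>i. i \<in> I \<Longrightarrow> g i \<in> bounded_degree d N"
  shows "card I \<le> (N + 1) ^ d"
proof -
  have "card I \<le> card ((\<lambda>a t. monomial d t a) ` exponents d N)"
    by (rule card_le_of_independent_on) (use assms finite_exponents in \<open>auto simp: bounded_degree_def\<close>)
  also have "\<dots> \<le> (N + 1) ^ d"
    using card_image_le[OF finite_exponents] by (simp only: card_exponents)
  finally show ?thesis .
qed

lemma bounded_degree_mono:
  assumes "N \<le> M"
  shows "bounded_degree d N \<subseteq> bounded_degree d M"
proof -
  have "exponents d N \<subseteq> exponents d M"
    unfolding exponents_def using assms by (intro PiE_mono) auto
  then show ?thesis
    unfolding bounded_degree_def by (intro complex_functions.span_mono image_mono)
qed

lemma bounded_degree_add: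
  "\<lbrakk>p \<in> bounded_degree d N; q \<in> bounded_degree d N\<rbrakk> \<Longrightarrow> (\<lambda>t. p t + q t) \<in> bounded_degree d N"
  using complex_functions.span_add[of p _ q] by (simp add: bounded_degree_def plus_fun_def)

lemma bounded_degree_scale:
  "p \<in> bounded_degree d N \<Longrightarrow> (\<lambda>t. c * p t) \<in> bounded_degree d N"
  using complex_functions.span_scale[of p] by (simp add: bounded_degree_def)

text \<open>Multiplication is bilinear and adds the exponents of monomials, so it suffices to induct over
  the span in one factor and then in the other.\<close>

lemma bounded_degree_mult:
  assumes "p \<in> bounded_degree d N" "q \<in> bounded_degree d M"
  shows "(\<lambda>t. p t * q t) \<in> bounded_degree d (N + M)"
proof -
  have mon: "(\<lambda>t. monomial d t a * monomial d t b) \<in> bounded_degree d (N + M)"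
    if "a \<in> exponents d N" "b \<in> exponents d M" for a b
  proof -
    let ?c = "restrict (\<lambda>k. a k + b k) {..<d}"
    have "?c \<in> exponents d (N + M)"
      using that by (auto simp: exponents_def PiE_iff intro!: add_mono)
    moreover have "monomial d t a * monomial d t b = monomial d t ?c" for t
      by (simp add: monomial_def power_add prod.distrib)
    ultimately show ?thesis
      unfolding bounded_degree_def by (auto intro!: complex_functions.span_base)
  qed
  have sub: "complex_functions.subspace {h. (\<lambda>t. h t * r t) \<in> bounded_degree d L}" for r L
  proof -
    have "0 \<in> bounded_degree d L" by (simp add: bounded_degree_def complex_functions.span_zero)
    then show ?thesis
      by (auto simp: complex_functions.subspace_def zero_fun_def distrib_right mult.assoc
          intro: bounded_degree_add bounded_degree_scale)
  qed
  have "(\<lambda>t. q t * monomial d t a) \<in> bounded_degree d (N + M)" if "a \<in> exponents d N" for a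
    using assms(2)[unfolded bounded_degree_def] sub
    by (rule complex_functions.span_induct) (use mon[OF that] in \<open>auto simp: mult.commute\<close>)
  then have *: "(\<lambda>t. monomial d t a * q t) \<in> bounded_degree d (N + M)" if "a \<in> exponents d N" for a
    using that by (simp add: mult.commute)
  show ?thesis
    using assms(1)[unfolded bounded_degree_def] sub
    by (rule complex_functions.span_induct) (use * in auto)
qed

lemma bounded_degree_const: "(\<lambda>t. c) \<in> bounded_degree d 0"
proof -
  have "(\<lambda>t. monomial d t (restrict (\<lambda>k. 0) {..<d})) \<in> bounded_degree d 0"
    unfolding bounded_degree_def exponents_def
    by (intro complex_functions.span_base imageI) auto
  from bounded_degree_scale[OF this, of c] show ?thesis by (simp add: monomial_def)
qed

lemma bounded_degree_coordinate:
  assumes "k < d"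
  shows "(\<lambda>t. t k) \<in> bounded_degree d 1"
proof -
  have "(\<lambda>t. monomial d t (restrict (\<lambda>j. if j = k then 1 else 0) {..<d})) \<in> bounded_degree d 1"
    unfolding bounded_degree_def exponents_def
    by (intro complex_functions.span_base imageI) (auto simp: PiE_iff extensional_def)
  moreover have "monomial d t (restrict (\<lambda>j. if j = k then 1 else 0) {..<d}) = t k" for t
    using assms by (simp add: monomial_def if_distrib[of "\<lambda>e. t _ ^ e"] cong: if_cong)
  ultimately show ?thesis by simp
qed

end

lemma bounded_degree_power:
  "p \<in> bounded_degree d N \<Longrightarrow> (\<lambda>t. p t ^ k) \<in> bounded_degree d (k * N)"
  by (induction k) (auto intro: bounded_degree_const bounded_degree_mult)

lemma bounded_degree_monomial:
  assumes "\<And>i. i < n \<Longrightarrow> p i \<in> bounded_degree d E" "\<And>i. i < n \<Longrightarrow> a i \<le> M"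
  shows "(\<lambda>t. monomial n (\<lambda>i. p i t) a) \<in> bounded_degree d (n * (M * E))"
  using assms
proof (induction n)
  case 0
  then show ?case by (simp add: monomial_def bounded_degree_const)
next
  case (Suc n)
  have "(\<lambda>t. p n t ^ a n) \<in> bounded_degree d (M * E)"
    using bounded_degree_power[of "p n" d E "a n"] Suc.prems bounded_degree_mono[of "a n * E" "M * E" d]
    by auto
  moreover have "(\<lambda>t. monomial n (\<lambda>i. p i t) a) \<in> bounded_degree d (n * (M * E))"
    using Suc by simp
  ultimately show ?case
    using bounded_degree_mult by (fastforce simp: monomial_def mult.commute add.commute)
qed

text \<open>For \<open>n > d\<close> the left side, of order \<open>M\<^sup>n\<close>, outgrows the right side, which is at most
  \<open>(C + 1)\<^sup>d (M + 1)\<^sup>d\<close>.\<close>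

lemma exponent_le_of_power_le:
  assumes "\<And>M::nat. (M + 1) ^ n \<le> (M * C + 1) ^ d"
  shows "n \<le> d"
proof (rule ccontr)
  assume "\<not> n \<le> d"
  then obtain k where n: "n = d + Suc k" using less_iff_Suc_add by (metis add_Suc_right not_le)
  \<comment> \<open>With this \<open>M\<close> the right side is at most \<open>M (M + 1)\<^sup>d\<close>, less than \<open>(M + 1)\<^sup>d\<^sup>+\<^sup>1\<close>.\<close>
  define M where "M = (C + 1) ^ d"
  have "(M + 1) ^ d * (M + 1) ^ Suc k \<le> (M * C + 1) ^ d"
    using assms[of M] by (simp only: n power_add)
  also have "\<dots> \<le> ((M + 1) * (C + 1)) ^ d" by (intro power_mono) auto
  also have "\<dots> = (M + 1) ^ d * M" by (simp only: power_mult_distrib M_def)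
  finally have "(M + 1) ^ Suc k \<le> M" by simp
  then have bound: "(M + 1) ^ Suc k \<le> M" .
  have "(M + 1) ^ 1 \<le> (M + 1) ^ Suc k" by (rule power_increasing) auto
  from order_trans[OF this bound] show False by simp
qed

section \<open>Affine spaces with coordinates\<close>

definition affine_form :: "nat \<Rightarrow> ((nat \<Rightarrow> complex) \<Rightarrow> complex) \<Rightarrow> bool" where
  "affine_form d h \<longleftrightarrow> (\<exists>\<beta> \<alpha>. \<forall>t. h t = \<beta> + (\<Sum>k<d. \<alpha> k * t k))"

lemma affine_form_const: "affine_form d (\<lambda>t. c)"
  unfolding affine_form_def by (rule exI[of _ c], rule exI[of _ "\<lambda>k. 0"]) simp

lemma affine_form_coordinate: "k < d \<Longrightarrow> affine_form d (\<lambda>t. t k)"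
  unfolding affine_form_def
  by (rule exI[of _ 0], rule exI[of _ "\<lambda>j. if j = k then 1 else 0"])
    (simp add: if_distrib[of "\<lambda>z. z * _"] cong: if_cong)

lemma affine_form_add:
  assumes "affine_form d p" "affine_form d q"
  shows "affine_form d (\<lambda>t. p t + q t)"
proof -
  obtain \<beta> \<alpha> \<delta> \<gamma> where "\<And>t. p t = \<beta> + (\<Sum>k<d. \<alpha> k * t k)" "\<And>t. q t = \<delta> + (\<Sum>k<d. \<gamma> k * t k)"
    using assms unfolding affine_form_def by metis
  then show ?thesis
    unfolding affine_form_def
    by (intro exI[of _ "\<beta> + \<delta>"] exI[of _ "\<lambda>k. \<alpha> k + \<gamma> k"]) (simp add: distrib_right sum.distrib)
qed

lemma affine_form_uminus:
  assumes "affine_form d p"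
  shows "affine_form d (\<lambda>t. - p t)"
proof -
  obtain \<beta> \<alpha> where "\<And>t. p t = \<beta> + (\<Sum>k<d. \<alpha> k * t k)"
    using assms unfolding affine_form_def by metis
  then show ?thesis
    unfolding affine_form_def
    by (intro exI[of _ "- \<beta>"] exI[of _ "\<lambda>k. - \<alpha> k"]) (simp add: sum_negf)
qed

lemma affine_form_diff:
  "\<lbrakk>affine_form d p; affine_form d q\<rbrakk> \<Longrightarrow> affine_form d (\<lambda>t. p t - q t)"
  using affine_form_add[of d p "\<lambda>t. - q t"] affine_form_uminus[of d q] by simp

lemmas affine_form_intros =
  affine_form_const affine_form_coordinate affine_form_add affine_form_uminus affine_form_diff

lemma affine_form_on_line:
  assumes "affine_form d h"
  shows "h (\<lambda>k. s k + l * (t k - s k)) = h s + l * (h t - h s)"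
proof -
  obtain \<beta> \<alpha> where h: "\<And>t. h t = \<beta> + (\<Sum>k<d. \<alpha> k * t k)"
    using assms unfolding affine_form_def by metis
  have "(\<Sum>k<d. \<alpha> k * (s k + l * (t k - s k))) =
      (\<Sum>k<d. \<alpha> k * s k) + l * ((\<Sum>k<d. \<alpha> k * t k) - (\<Sum>k<d. \<alpha> k * s k))"
    by (simp add: sum_distrib_left sum.distrib sum_subtractf algebra_simps)
  then show ?thesis by (simp add: h algebra_simps)
qed

lemma affine_form_cong:
  assumes "affine_form d h" "\<And>k. k < d \<Longrightarrow> s k = t k"
  shows "h s = h t"
  using assms unfolding affine_form_def by force

lemma affine_form_bounded_degree:
  assumes "affine_form d h"
  shows "h \<in> bounded_degree d 1"
proof -
  obtain \<beta> \<alpha> where h: "h = (\<lambda>t. \<beta> + (\<Sum>k<d. \<alpha> k * t k))"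
    using assms unfolding affine_form_def by blast
  have "(\<lambda>t. \<Sum>k<m. \<alpha> k * t k) \<in> bounded_degree d 1" if "m \<le> d" for m
    using that
  proof (induction m)
    case 0
    then show ?case using bounded_degree_const bounded_degree_mono[of 0 1 d] by auto
  next
    case (Suc m)
    then show ?case
      by (auto intro!: bounded_degree_add bounded_degree_scale bounded_degree_coordinate simp flip: One_nat_def)
  qed
  then show ?thesis
    unfolding h using bounded_degree_const bounded_degree_mono[of 0 1 d]
    by (intro bounded_degree_add) auto
qed

text \<open>An affine subspace of a matrix space, given by a parametrization \<open>\<phi>\<close> whose \<open>d\<close> parameters can
  be read off as entries of the matrix. Points of the parameter space are infinite sequences, of
  which only the first \<open>d\<close> terms matter; this avoids a type for each dimension.\<close>

locale coordinate_affine_space =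
  fixes d :: nat and \<phi> :: "(nat \<Rightarrow> complex) \<Rightarrow> complex^'n^'m" and row :: "nat \<Rightarrow> 'm" and col :: "nat \<Rightarrow> 'n"
  assumes entry: "affine_form d (\<lambda>t. \<phi> t $ i $ j)"
    and coordinate: "k < d \<Longrightarrow> \<phi> t $ row k $ col k = t k"
begin

text \<open>These are the equations of the subspace: every entry is a fixed affine function of the
  \<open>d\<close> entries that serve as coordinates.\<close>

lemma in_range_iff: "A \<in> range \<phi> \<longleftrightarrow> A = \<phi> (\<lambda>k. A $ row k $ col k)"
proof
  assume "A \<in> range \<phi>"
  then obtain t where A: "A = \<phi> t" by auto
  show "A = \<phi> (\<lambda>k. A $ row k $ col k)"
    unfolding vec_eq_iff A
    by (intro allI affine_form_cong[OF entry]) (simp add: coordinate)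
qed auto

lemma closedin_range: "closedin zariski_topology (range \<phi>)"
proof -
  let ?p = "\<lambda>i j A. A $ i $ j - \<phi> (\<lambda>k. A $ row k $ col k) $ i $ j"
  have "?p i j \<in> polynomial_functions" for i j
  proof -
    obtain \<beta> \<alpha> where e: "\<And>t. \<phi> t $ i $ j = \<beta> + (\<Sum>k<d. \<alpha> k * t k)"
      using entry[of i j] unfolding affine_form_def by metis
    show ?thesis
      unfolding e
      by (intro polynomial_functions_diff polynomial_functions.add polynomial_functions.mult
          polynomial_functions_sum polynomial_functions.const polynomial_functions.entry)
  qed
  then have "range (\<lambda>(i, j). ?p i j) \<subseteq> polynomial_functions" by (simp add: image_subset_iff)
  moreover have "range \<phi> = zero_locus (range (\<lambda>(i, j). ?p i j))"
    unfolding set_eq_iff in_range_iff by (simp add: zero_locus_def vec_eq_iff)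
  ultimately show ?thesis
    unfolding closedin_zariski_topology by (intro exI conjI)
qed

lemma image_line:
  "\<phi> s + mat_scale l (\<phi> t - \<phi> s) = \<phi> (\<lambda>k. s k + l * (t k - s k))"
  using affine_form_on_line[OF entry]
  by (simp add: vec_eq_iff mat_scale_def)

lemma irreducible_image:
  assumes "T \<noteq> {}" "\<And>s t l. \<lbrakk>s \<in> T; t \<in> T\<rbrakk> \<Longrightarrow> (\<lambda>k. s k + l * (t k - s k)) \<in> T"
  shows "irreducible_in zariski_topology (\<phi> ` T)"
  by (rule irreducible_in_zariski_affine) (use assms in \<open>auto simp: image_line\<close>)

lemma irreducible_range: "irreducible_in zariski_topology (range \<phi>)"
  by (rule irreducible_image) auto

lemma entry_bounded_degree: "(\<lambda>t. \<phi> t $ i $ j) \<in> bounded_degree d 1"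
  by (rule affine_form_bounded_degree) (rule entry)

lemma pullback_bounded_degree:
  "p \<in> polynomial_functions \<Longrightarrow> \<exists>N. (\<lambda>t. p (\<phi> t)) \<in> bounded_degree d N"
proof (induction rule: polynomial_functions.induct)
  case (const k)
  show ?case using bounded_degree_const by blast
next
  case (entry i j)
  show ?case using entry_bounded_degree by blast
next
  case (add p q)
  then obtain N M where "(\<lambda>t. p (\<phi> t)) \<in> bounded_degree d N" "(\<lambda>t. q (\<phi> t)) \<in> bounded_degree d M"
    by auto
  then show ?case
    using bounded_degree_mono[of N "N + M" d] bounded_degree_mono[of M "N + M" d]
    by (intro exI[of _ "N + M"] bounded_degree_add) auto
next
  case (mult p q)
  then show ?case using bounded_degree_mult by blast
qed

text \<open>The counting argument. Let \<open>E\<close> bound the degrees of the \<open>f i\<close> in the parameters. Their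
  monomials with exponents at most \<open>M\<close> are independent and have degree at most \<open>n M E\<close>, whence
  \<open>(M + 1)\<^sup>n \<le> (n M E + 1)\<^sup>d\<close> for all \<open>M\<close>.\<close>

lemma chain_length_le:
  assumes closed: "\<And>i. i \<le> n \<Longrightarrow> closedin zariski_topology (Z i)"
    and irr: "\<And>i. i \<le> n \<Longrightarrow> irreducible_in zariski_topology (Z i)"
    and strict: "\<And>i. i < n \<Longrightarrow> Z i \<subset> Z (Suc i)"
    and sub: "Z n \<subseteq> range \<phi>"
  shows "n \<le> d"
proof -
  have "\<exists>p\<in>polynomial_functions. (\<forall>A\<in>Z i. p A = 0) \<and> (\<exists>A\<in>Z (Suc i). p A \<noteq> 0)" if "i < n" for i
  proof -
    obtain A where "A \<in> Z (Suc i)" "A \<notin> Z i" using strict \<open>i < n\<close> by blast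
    moreover obtain P where "P \<subseteq> polynomial_functions" "Z i = zero_locus P"
      using closed[of i] \<open>i < n\<close> unfolding closedin_zariski_topology by auto
    ultimately show ?thesis by (auto simp: zero_locus_def)
  qed
  then obtain f where f: "\<And>i. i < n \<Longrightarrow> f i \<in> polynomial_functions"
    "\<And>i A. \<lbrakk>i < n; A \<in> Z i\<rbrakk> \<Longrightarrow> f i A = 0" "\<And>i. i < n \<Longrightarrow> \<exists>A\<in>Z (Suc i). f i A \<noteq> 0"
    by metis
  have "\<forall>i. \<exists>N. i < n \<longrightarrow> (\<lambda>t. f i (\<phi> t)) \<in> bounded_degree d N"
    using pullback_bounded_degree f(1) by blast
  then obtain e where e: "\<And>i. i < n \<Longrightarrow> (\<lambda>t. f i (\<phi> t)) \<in> bounded_degree d (e i)"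
    by metis
  define E where "E = (\<Sum>i<n. e i)"
  have fE: "(\<lambda>t. f i (\<phi> t)) \<in> bounded_degree d E" if "i < n" for i
  proof -
    have "e i \<le> E" unfolding E_def using that by (intro member_le_sum) auto
    then show ?thesis using e[OF that] bounded_degree_mono by blast
  qed
  have "(M + 1) ^ n \<le> (M * (n * E) + 1) ^ d" for M
  proof -
    have "independent_on (Z n) (exponents n M) (\<lambda>a A. monomial n (\<lambda>i. f i A) a)"
      by (rule independent_on_monomials_of_chain) (use irr strict f in auto)
    then have "independent_on UNIV (exponents n M) (\<lambda>a t. monomial n (\<lambda>i. f i (\<phi> t)) a)"
      using sub unfolding independent_on_def by blast
    then have "card (exponents n M) \<le> (n * (M * E) + 1) ^ d"
    proof (rule card_le_of_independent_on_bounded_degree[OF finite_exponents])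
      fix a assume "a \<in> exponents n M"
      then have "a i \<le> M" if "i < n" for i using that by (auto simp: exponents_def)
      then show "(\<lambda>t. monomial n (\<lambda>i. f i (\<phi> t)) a) \<in> bounded_degree d (n * (M * E))"
        by (intro bounded_degree_monomial fE)
    qed
    then show ?thesis by (simp add: card_exponents mult_ac)
  qed
  then show ?thesis by (rule exponent_le_of_power_le)
qed

text \<open>The flag of the subspaces where all coordinates from the \<open>i\<close>-th on are zero; the \<open>i\<close>-th unit
  vector separates two consecutive ones.\<close>

lemma ex_chain:
  "\<exists>Z. (\<forall>i\<le>d. closedin zariski_topology (Z i) \<and> irreducible_in zariski_topology (Z i) \<and> Z i \<subseteq> range \<phi>)
    \<and> (\<forall>i<d. Z i \<subset> Z (Suc i))"
proof -
  define T :: "nat \<Rightarrow> (nat \<Rightarrow> complex) set" where "T i = {t. \<forall>k\<in>{i..<d}. t k = 0}" for i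
  have "irreducible_in zariski_topology (\<phi> ` T i)" for i
    by (rule irreducible_image) (auto simp: T_def)
  moreover have "closedin zariski_topology (\<phi> ` T i)" for i
  proof -
    have "\<phi> ` T i = range \<phi> \<inter> (\<Inter>k\<in>{i..<d}. {A. A $ row k $ col k = 0})"
      using coordinate by (auto simp: T_def)
    also have "closedin zariski_topology \<dots>"
    proof (cases "i < d")
      case True
      then show ?thesis
        by (intro closedin_Int closedin_range closedin_INT closedin_zariski_zeros polynomial_functions.entry) auto
    qed (simp add: closedin_range)
    finally show ?thesis .
  qed
  moreover have "\<phi> ` T i \<subset> \<phi> ` T (Suc i)" if "i < d" for i
  proof -
    let ?t = "\<lambda>k. if k = i then 1 else 0"
    have "\<phi> ?t \<in> \<phi> ` T (Suc i)" by (auto simp: T_def)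
    moreover have "\<phi> ?t \<notin> \<phi> ` T i"
    proof
      assume "\<phi> ?t \<in> \<phi> ` T i"
      then obtain s where "s \<in> T i" "\<phi> ?t = \<phi> s" by auto
      then show False using coordinate[OF that, of ?t] coordinate[OF that, of s] that
        by (simp add: T_def)
    qed
    moreover have "T i \<subseteq> T (Suc i)" by (auto simp: T_def)
    ultimately show ?thesis by blast
  qed
  ultimately show ?thesis by (intro exI[of _ "\<lambda>i. \<phi> ` T i"]) auto
qed

lemma krull_dim_range: "krull_dim (zariski_subspace (range \<phi>)) = enat d"
proof -
  have closed: "closedin (zariski_subspace (range \<phi>)) Z \<longleftrightarrow> Z \<subseteq> range \<phi> \<and> closedin zariski_topology Z" for Z
    using closedin_closed_subtopology[OF closedin_range] by auto
  let ?chain = "\<lambda>n Z. (\<forall>i\<le>n. closedin (zariski_subspace (range \<phi>)) (Z i) \<and>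
      irreducible_in (zariski_subspace (range \<phi>)) (Z i)) \<and> (\<forall>i<n. Z i \<subset> Z (Suc i))"
  have le: "n \<le> d" if chain: "?chain n Z" for n Z
  proof (rule chain_length_le)
    show "closedin zariski_topology (Z i)" "irreducible_in zariski_topology (Z i)" if "i \<le> n" for i
      using chain that unfolding closed irreducible_in_subtopology by blast+
    show "Z i \<subset> Z (Suc i)" if "i < n" for i using chain that by blast
    show "Z n \<subseteq> range \<phi>" using chain unfolding closed by blast
  qed
  obtain Z where "?chain d Z"
    using ex_chain unfolding closed irreducible_in_subtopology by blast
  then have "enat d \<in> {enat n |n. \<exists>Z. ?chain n Z}" by blast
  moreover have "m \<le> enat d" if "m \<in> {enat n |n. \<exists>Z. ?chain n Z}" for m
  proof -
    obtain n Z where "m = enat n" "?chain n Z" using \<open>m \<in> _\<close> by blast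
    then show ?thesis using le[of n Z] by simp
  qed
  ultimately show ?thesis
    unfolding krull_dim_def by (intro antisym Sup_least Sup_upper)
qed

end

section \<open>The multiplicative Hom-Lie structures on \<open>u2\<close>\<close>

definition upper :: "complex \<Rightarrow> complex \<Rightarrow> complex \<Rightarrow> complex^2^2" where
  "upper x y z = (\<chi> i j. if i = 1 then (if j = 1 then x else y) else (if j = 1 then 0 else z))"

lemma upper_nth [simp]:
  "upper x y z $ 1 $ 1 = x" "upper x y z $ 1 $ 2 = y" "upper x y z $ 2 $ 1 = 0" "upper x y z $ 2 $ 2 = z"
  by (simp_all add: upper_def)

lemma upper_eq_iff [simp]: "upper x y z = upper x' y' z' \<longleftrightarrow> x = x' \<and> y = y' \<and> z = z'"
  by (auto simp: vec_eq_iff forall_2)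

lemma upper_zero [simp]: "0 = upper x y z \<longleftrightarrow> x = 0 \<and> y = 0 \<and> z = 0" "upper x y z = 0 \<longleftrightarrow> x = 0 \<and> y = 0 \<and> z = 0"
  by (auto simp: vec_eq_iff forall_2)

lemma upper_arith [simp]:
  "upper x y z + upper x' y' z' = upper (x + x') (y + y') (z + z')"
  "mat_scale k (upper x y z) = upper (k * x) (k * y) (k * z)"
  "commutator (upper x y z) (upper x' y' z') = upper 0 (x * y' + y * z' - x' * y - y' * z) 0"
  by (simp_all add: vec_eq_iff forall_2 mat_scale_def commutator_def matrix_matrix_mult_def sum_2 algebra_simps)

lemma in_u2_iff: "A \<in> u2 \<longleftrightarrow> (\<exists>x y z. A = upper x y z)"
proof
  assume "A \<in> u2"
  then have "A = upper (A $ 1 $ 1) (A $ 1 $ 2) (A $ 2 $ 2)"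
    by (simp add: vec_eq_iff forall_2 u2_def)
  then show "\<exists>x y z. A = upper x y z" by blast
qed (auto simp: u2_def)

lemma u2_basis_upper:
  "u2_basis 1 = upper 1 0 0" "u2_basis 2 = upper 0 1 0" "u2_basis 3 = upper 0 0 1"
  by (auto simp: u2_basis_def matrix_unit_def vec_eq_iff forall_2)

lemma represents_u2_iff:
  "u2.represents A D \<longleftrightarrow>
     D (upper 1 0 0) = upper (A $ 1 $ 1) (A $ 2 $ 1) (A $ 3 $ 1) \<and>
     D (upper 0 1 0) = upper (A $ 1 $ 2) (A $ 2 $ 2) (A $ 3 $ 2) \<and>
     D (upper 0 0 1) = upper (A $ 1 $ 3) (A $ 2 $ 3) (A $ 3 $ 3)"
  by (simp add: u2.represents_def forall_3 sum_3 u2_basis_upper)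

text \<open>The conditions come from the basis vectors: multiplicativity on \<open>[E\<^sub>1\<^sub>1, E\<^sub>1\<^sub>2] = E\<^sub>1\<^sub>2\<close> gives the first
  three, the Hom-Jacobi identity on the basis gives the fourth, and multiplicativity on
  \<open>[E\<^sub>1\<^sub>1, E\<^sub>2\<^sub>2] = 0\<close> gives the last.\<close>

lemma HLie_m_u2_iff:
  "A \<in> u2.HLie_m \<longleftrightarrow>
     A $ 1 $ 2 = 0 \<and> A $ 3 $ 2 = 0 \<and>
     A $ 2 $ 2 = A $ 2 $ 2 * (A $ 1 $ 1 - A $ 3 $ 1) \<and>
     A $ 1 $ 1 - A $ 3 $ 1 = A $ 3 $ 3 - A $ 1 $ 3 \<and>
     (A $ 2 $ 1 + A $ 2 $ 3) * (A $ 1 $ 1 - A $ 3 $ 1) = 0" (is "_ \<longleftrightarrow> ?R")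
proof
  assume "A \<in> u2.HLie_m"
  then obtain D where D: "u2.multiplicative_hom_lie_structure D" "u2.represents A D"
    by (auto simp: u2.HLie_m_def)
  let ?e1 = "upper 1 0 0" and ?e2 = "upper 0 1 0" and ?e3 = "upper 0 0 1"
  have e: "?e1 \<in> u2" "?e2 \<in> u2" "?e3 \<in> u2" by (auto simp: u2_def)
  have mult: "D (commutator x y) = commutator (D x) (D y)" if "x \<in> u2" "y \<in> u2" for x y
    using D that by (auto simp: u2.multiplicative_hom_lie_structure_def)
  have hom: "commutator (D ?e1) (commutator ?e2 ?e3) + commutator (D ?e2) (commutator ?e3 ?e1)
      + commutator (D ?e3) (commutator ?e1 ?e2) = 0"
    using D(1) e unfolding u2.multiplicative_hom_lie_structure_def u2.hom_lie_structure_def by blast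
  have zero: "D (upper 0 0 0) = upper 0 0 0"
  proof -
    have "D (mat_scale 0 ?e1) = mat_scale 0 (D ?e1)"
      using D(1) e unfolding u2.multiplicative_hom_lie_structure_def u2.hom_lie_structure_def u2.linear_map_def by blast
    then show ?thesis using D(2) by (simp add: represents_u2_iff)
  qed
  have De: "D ?e1 = upper (A $ 1 $ 1) (A $ 2 $ 1) (A $ 3 $ 1)"
    "D ?e2 = upper (A $ 1 $ 2) (A $ 2 $ 2) (A $ 3 $ 2)"
    "D ?e3 = upper (A $ 1 $ 3) (A $ 2 $ 3) (A $ 3 $ 3)"
    using D(2) by (auto simp: represents_u2_iff)
  have "A $ 1 $ 2 = 0 \<and> A $ 3 $ 2 = 0 \<and> A $ 2 $ 2 = A $ 2 $ 2 * (A $ 1 $ 1 - A $ 3 $ 1)"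
    using mult[OF e(1,2)] by (auto simp: De algebra_simps)
  moreover have w: "A $ 1 $ 1 - A $ 3 $ 1 = A $ 3 $ 3 - A $ 1 $ 3"
    using hom calculation by (simp add: De algebra_simps)
  moreover have "A $ 1 $ 1 * A $ 2 $ 3 + A $ 2 $ 1 * A $ 3 $ 3 - A $ 1 $ 3 * A $ 2 $ 1 - A $ 2 $ 3 * A $ 3 $ 1 = 0"
    using mult[OF e(1,3)] zero by (simp add: De)
  then have "(A $ 2 $ 1 + A $ 2 $ 3) * (A $ 1 $ 1 - A $ 3 $ 1) = 0"
    using w by algebra
  ultimately show ?R by blast
next
  assume R: ?R
  define D :: "complex^2^2 \<Rightarrow> complex^2^2" where
    "D X = upper (A $ 1 $ 1 * X $ 1 $ 1 + A $ 1 $ 3 * X $ 2 $ 2)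
      (A $ 2 $ 1 * X $ 1 $ 1 + A $ 2 $ 2 * X $ 1 $ 2 + A $ 2 $ 3 * X $ 2 $ 2)
      (A $ 3 $ 1 * X $ 1 $ 1 + A $ 3 $ 3 * X $ 2 $ 2)" for X
  define w where "w = A $ 1 $ 1 - A $ 3 $ 1"
  have w: "A $ 3 $ 1 = A $ 1 $ 1 - w" "A $ 3 $ 3 = A $ 1 $ 3 + w"
    "w * A $ 2 $ 2 = A $ 2 $ 2" "w * A $ 2 $ 3 = - (w * A $ 2 $ 1)"
    using R unfolding w_def by algebra+
  have "u2.represents A D"
    using R by (simp add: represents_u2_iff D_def)
  moreover have "u2.linear_map D"
    by (auto simp: u2.linear_map_def in_u2_iff D_def algebra_simps)
  moreover have "D (commutator X Y) = commutator (D X) (D Y)" if "X \<in> u2" "Y \<in> u2" for X Y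
  proof -
    obtain x y z x' y' z' where XY: "X = upper x y z" "Y = upper x' y' z'"
      using \<open>X \<in> u2\<close> \<open>Y \<in> u2\<close> unfolding in_u2_iff by blast
    \<comment> \<open>For every \<open>X\<close>, the difference of the diagonal entries of \<open>D X\<close> is \<open>w\<close> times that of \<open>X\<close>, so the
      off-diagonal entry of a bracket of images only involves \<open>w\<close> times the second row of \<open>A\<close>.\<close>
    have second: "w * (A $ 2 $ 1 * x + A $ 2 $ 2 * y + A $ 2 $ 3 * z) = w * A $ 2 $ 1 * (x - z) + A $ 2 $ 2 * y"
      for x y z
    proof -
      have "w * (A $ 2 $ 1 * x + A $ 2 $ 2 * y + A $ 2 $ 3 * z)
          = w * A $ 2 $ 1 * x + (w * A $ 2 $ 2) * y + (w * A $ 2 $ 3) * z"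
        by (simp add: algebra_simps)
      then show ?thesis unfolding w(3,4) by (simp add: algebra_simps)
    qed
    have "(x - z) * (w * (A $ 2 $ 1 * x' + A $ 2 $ 2 * y' + A $ 2 $ 3 * z'))
        - (x' - z') * (w * (A $ 2 $ 1 * x + A $ 2 $ 2 * y + A $ 2 $ 3 * z))
        = A $ 2 $ 2 * (x * y' + y * z' - x' * y - y' * z)"
      unfolding second by (simp add: algebra_simps)
    then show ?thesis
      unfolding XY by (simp add: D_def w(1,2) algebra_simps)
  qed
  moreover have "commutator (D X) (commutator Y Z) + commutator (D Y) (commutator Z X)
      + commutator (D Z) (commutator X Y) = 0" if "X \<in> u2" "Y \<in> u2" "Z \<in> u2" for X Y Z
    using that by (auto simp: in_u2_iff D_def w(1,2) algebra_simps)
  ultimately show "A \<in> u2.HLie_m"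
    by (auto simp: u2.HLie_m_def u2.multiplicative_hom_lie_structure_def u2.hom_lie_structure_def)
qed

lemma V1_iff:
  "A \<in> V1 \<longleftrightarrow> A $ 1 $ 2 = 0 \<and> A $ 2 $ 2 = 0 \<and> A $ 3 $ 2 = 0 \<and> A $ 3 $ 1 = A $ 1 $ 1 \<and> A $ 3 $ 3 = A $ 1 $ 3"
  unfolding V1_def by (auto simp: vec_eq_iff forall_3)

lemma V2_iff:
  "A \<in> V2 \<longleftrightarrow> A $ 1 $ 2 = 0 \<and> A $ 3 $ 2 = 0 \<and> A $ 2 $ 3 = - A $ 2 $ 1 \<and> A $ 3 $ 1 = A $ 1 $ 1 - 1 \<and> A $ 3 $ 3 = A $ 1 $ 3 + 1"
  unfolding V2_def by (auto simp: vec_eq_iff forall_3)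

lemma V3_iff:
  "A \<in> V3 \<longleftrightarrow> A $ 1 $ 2 = 0 \<and> A $ 2 $ 2 = 0 \<and> A $ 3 $ 2 = 0 \<and> A $ 2 $ 3 = - A $ 2 $ 1 \<and> A $ 3 $ 3 = A $ 1 $ 1 - A $ 3 $ 1 + A $ 1 $ 3"
  unfolding V3_def by (auto simp: vec_eq_iff forall_3)

text \<open>\<open>a\<^sub>2\<^sub>2 = a\<^sub>2\<^sub>2w\<close> means \<open>a\<^sub>2\<^sub>2 = 0\<close> or \<open>w = 1\<close>. If \<open>w = 0\<close> then \<open>a\<^sub>2\<^sub>2 = 0\<close> and the matrix is in \<open>V1\<close>; otherwise
  \<open>a\<^sub>2\<^sub>3 = - a\<^sub>2\<^sub>1\<close>, and the alternatives \<open>w = 1\<close> and \<open>a\<^sub>2\<^sub>2 = 0\<close> give \<open>V2\<close> and \<open>V3\<close>.\<close>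

lemma HLie_m_u2_eq: "u2.HLie_m = V1 \<union> V2 \<union> V3"
proof (rule set_eqI)
  fix A :: "complex^3^3"
  \<comment> \<open>In terms of these, \<open>HLie_m\<close> is \<open>w = v\<close>, \<open>a\<^sub>2\<^sub>2 = a\<^sub>2\<^sub>2w\<close>, \<open>(a\<^sub>2\<^sub>1 + a\<^sub>2\<^sub>3)w = 0\<close>, while the sets have
    \<open>w = v = 0\<close>, \<open>w = v = 1\<close> and \<open>w = v\<close>.\<close>
  define w v where "w = A $ 1 $ 1 - A $ 3 $ 1" and "v = A $ 3 $ 3 - A $ 1 $ 3"
  then have "A $ 3 $ 1 = A $ 1 $ 1 - w" "A $ 3 $ 3 = A $ 1 $ 3 + v" by simp_all
  then show "A \<in> u2.HLie_m \<longleftrightarrow> A \<in> V1 \<union> V2 \<union> V3"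
    unfolding HLie_m_u2_iff Un_iff V1_iff V2_iff V3_iff
    by (auto simp: add_eq_0_iff)
qed

text \<open>The parameters are listed in the order of the letters in the definitions of the three sets.\<close>

definition V1_chart :: "(nat \<Rightarrow> complex) \<Rightarrow> complex^3^3" where
  "V1_chart t = vector [vector [t 0, 0, t 2], vector [t 1, 0, t 3], vector [t 0, 0, t 2]]"

definition V2_chart :: "(nat \<Rightarrow> complex) \<Rightarrow> complex^3^3" where
  "V2_chart t = vector [vector [t 0, 0, t 3], vector [t 1, t 2, - t 1], vector [t 0 - 1, 0, t 3 + 1]]"

definition V3_chart :: "(nat \<Rightarrow> complex) \<Rightarrow> complex^3^3" where
  "V3_chart t = vector [vector [t 0, 0, t 3], vector [t 1, 0, - t 1], vector [t 2, 0, t 0 - t 2 + t 3]]"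

lemma less_4_cases: "k < 4 \<Longrightarrow> k = 0 \<or> k = 1 \<or> k = 2 \<or> k = (3::nat)"
  by auto

interpretation V1: coordinate_affine_space 4 V1_chart "\<lambda>k. [1, 2, 1, 2] ! k" "\<lambda>k. [1, 1, 3, 3] ! k"
proof
  show "affine_form 4 (\<lambda>t. V1_chart t $ i $ j)" for i j
    using exhaust_3[of i] exhaust_3[of j] by (auto simp: V1_chart_def intro!: affine_form_intros)
  show "V1_chart t $ ([1, 2, 1, 2] ! k) $ ([1, 1, 3, 3] ! k) = t k" if "k < 4" for k t
    using less_4_cases[OF that] by (auto simp: V1_chart_def)
qed

interpretation V2: coordinate_affine_space 4 V2_chart "\<lambda>k. [1, 2, 2, 1] ! k" "\<lambda>k. [1, 1, 2, 3] ! k"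
proof
  show "affine_form 4 (\<lambda>t. V2_chart t $ i $ j)" for i j
    using exhaust_3[of i] exhaust_3[of j] by (auto simp: V2_chart_def intro!: affine_form_intros)
  show "V2_chart t $ ([1, 2, 2, 1] ! k) $ ([1, 1, 2, 3] ! k) = t k" if "k < 4" for k t
    using less_4_cases[OF that] by (auto simp: V2_chart_def)
qed

interpretation V3: coordinate_affine_space 4 V3_chart "\<lambda>k. [1, 2, 3, 1] ! k" "\<lambda>k. [1, 1, 1, 3] ! k"
proof
  show "affine_form 4 (\<lambda>t. V3_chart t $ i $ j)" for i j
    using exhaust_3[of i] exhaust_3[of j] by (auto simp: V3_chart_def intro!: affine_form_intros)
  show "V3_chart t $ ([1, 2, 3, 1] ! k) $ ([1, 1, 1, 3] ! k) = t k" if "k < 4" for k t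
    using less_4_cases[OF that] by (auto simp: V3_chart_def)
qed

lemma range_charts: "range V1_chart = V1" "range V2_chart = V2" "range V3_chart = V3"
  unfolding set_eq_iff V1.in_range_iff V2.in_range_iff V3.in_range_iff V1_iff V2_iff V3_iff
  by (auto simp: V1_chart_def V2_chart_def V3_chart_def vec_eq_iff forall_3)

text \<open>Each set has a point outside the other two: \<open>V1\<close> leaves \<open>a\<^sub>2\<^sub>1 + a\<^sub>2\<^sub>3\<close> free, \<open>V2\<close> leaves \<open>a\<^sub>2\<^sub>2\<close> free,
  and \<open>V3\<close> leaves \<open>w = a\<^sub>1\<^sub>1 - a\<^sub>3\<^sub>1\<close> free.\<close>

lemma V_incomparable:
  "\<not> V1 \<subseteq> V2" "\<not> V1 \<subseteq> V3" "\<not> V2 \<subseteq> V1" "\<not> V2 \<subseteq> V3" "\<not> V3 \<subseteq> V1" "\<not> V3 \<subseteq> V2"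
proof -
  let ?A1 = "vector [vector [0, 0, 0], vector [1, 0, 0], vector [0, 0, 0]] :: complex^3^3"
  let ?A2 = "vector [vector [0, 0, 0], vector [0, 1, 0], vector [- 1, 0, 1]] :: complex^3^3"
  let ?A3 = "vector [vector [0, 0, 0], vector [0, 0, 0], vector [1, 0, - 1]] :: complex^3^3"
  have "?A1 \<in> V1 - V2 - V3" "?A2 \<in> V2 - V1 - V3" "?A3 \<in> V3 - V1 - V2"
    by (auto simp: V1_iff V2_iff V3_iff)
  then show "\<not> V1 \<subseteq> V2" "\<not> V1 \<subseteq> V3" "\<not> V2 \<subseteq> V1" "\<not> V2 \<subseteq> V3" "\<not> V3 \<subseteq> V1" "\<not> V3 \<subseteq> V2"
    by blast+
qed

theorem theorem4p7:
  shows "closedin zariski_topology u2.HLie_m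
    \<and> u2.HLie_m = V1 \<union> V2 \<union> V3
    \<and> irreducible_components (zariski_subspace u2.HLie_m) = {V1, V2, V3}
    \<and> V1 \<noteq> V2 \<and> V1 \<noteq> V3 \<and> V2 \<noteq> V3
    \<and> krull_dim (zariski_subspace V1) = 4
    \<and> krull_dim (zariski_subspace V2) = 4
    \<and> krull_dim (zariski_subspace V3) = 4"
proof -
  note closed = V1.closedin_range V2.closedin_range V3.closedin_range
  note irr = V1.irreducible_range V2.irreducible_range V3.irreducible_range
  have HLie: "closedin zariski_topology u2.HLie_m"
    unfolding HLie_m_u2_eq using closed by (simp add: range_charts closedin_Un)
  have "irreducible_components (zariski_subspace u2.HLie_m) = {V1, V2, V3}"
  proof (rule irreducible_components_finite_closed_cover)
    show "closedin (zariski_subspace u2.HLie_m) C" if "C \<in> {V1, V2, V3}" for C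
      using that closed unfolding closedin_closed_subtopology[OF HLie]
      by (auto simp: range_charts HLie_m_u2_eq)
    show "irreducible_in (zariski_subspace u2.HLie_m) C" if "C \<in> {V1, V2, V3}" for C
      using that irr by (auto simp: irreducible_in_subtopology range_charts HLie_m_u2_eq)
    show "C = C'" if "C \<in> {V1, V2, V3}" "C' \<in> {V1, V2, V3}" "C \<subseteq> C'" for C C'
      using that V_incomparable by auto
  qed (auto simp: HLie_m_u2_eq)
  moreover have "V1 \<noteq> V2" "V1 \<noteq> V3" "V2 \<noteq> V3" using V_incomparable by auto
  moreover have "krull_dim (zariski_subspace V1) = 4" "krull_dim (zariski_subspace V2) = 4"
    "krull_dim (zariski_subspace V3) = 4"
    using V1.krull_dim_range V2.krull_dim_range V3.krull_dim_range
    by (simp_all add: range_charts numeral_eq_enat)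
  ultimately show ?thesis using HLie HLie_m_u2_eq by blast
qed

end
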